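(* Let $H$ be a hypergraph. If Avoider (resp. Enforcer) wins on $H$ as last player, then Avoider (resp. Enforcer) also wins on $H$ as second-to-last player.
   Context: A hypergraph $H$ has a finite vertex set $V(H)$ and an edge set $E(H)\subseteq 2^{V(H)}$ (the empty edge is allowed). In the Avoider-Enforcer game on $H$, two players, Avoider and Enforcer, alternately pick one previously unpicked vertex of $H$ until all vertices have been picked. Enforcer wins if at the end Avoider has picked all the vertices of some edge of $H$; otherwise Avoider wins (in particular Enforcer wins if $\varnothing\in E(H)$). The last player is the player who makes the last move of the game: this is the first player if $|V(H)|$ is odd and the second player if $|V(H)|$ is even; the other player is the second-to-last player. A player "wins on $H$ as last (resp. second-to-last) player" if that player has a winning strategy for the game on $H$ when they are the last (resp. second-to-last) player. *)

theory Defs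
  imports Main
begin

definition hypergraph :: "'a set \<Rightarrow> 'a set set \<Rightarrow> bool" where
  "hypergraph V E \<longleftrightarrow> finite V \<and> E \<subseteq> Pow V"

datatype player = Avoider | Enforcer

fun opponent :: "player \<Rightarrow> player" where
  "opponent Avoider = Enforcer"
| "opponent Enforcer = Avoider"

text \<open>
  A history is the list of the vertices picked so far, in the order of picking, by both players.
  The parameter \<open>f\<close> is always the first player; \<open>mover f n\<close> is the player to move
  once \<open>n\<close> vertices have been picked.
\<close>

definition history :: "'a set \<Rightarrow> 'a list \<Rightarrow> bool" where
  "history V h \<longleftrightarrow> distinct h \<and> set h \<subseteq> V"

definition complete_play :: "'a set \<Rightarrow> 'a list \<Rightarrow> bool" where
  "complete_play V h \<longleftrightarrow> distinct h \<and> set h = V"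

definition mover :: "player \<Rightarrow> nat \<Rightarrow> player" where
  "mover f n = (if even n then f else opponent f)"

definition picked_by :: "player \<Rightarrow> player \<Rightarrow> 'a list \<Rightarrow> 'a set" where
  "picked_by f P h = {h ! i | i. i < length h \<and> mover f i = P}"

fun wins_play :: "'a set set \<Rightarrow> player \<Rightarrow> player \<Rightarrow> 'a list \<Rightarrow> bool" where
  "wins_play E f Enforcer h \<longleftrightarrow> (\<exists>e\<in>E. e \<subseteq> picked_by f Avoider h)"
| "wins_play E f Avoider h \<longleftrightarrow> \<not> (\<exists>e\<in>E. e \<subseteq> picked_by f Avoider h)"

text \<open>
  A strategy for \<open>P\<close> maps histories to vertices; only its values at incomplete histories
  where \<open>P\<close> is to move matter, and there it has to select an unpicked vertex.
\<close>

definition strategy :: "'a set \<Rightarrow> player \<Rightarrow> player \<Rightarrow> ('a list \<Rightarrow> 'a) \<Rightarrow> bool" where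
  "strategy V f P s \<longleftrightarrow>
     (\<forall>h. history V h \<and> set h \<noteq> V \<and> mover f (length h) = P \<longrightarrow> s h \<in> V - set h)"

definition follows :: "player \<Rightarrow> player \<Rightarrow> ('a list \<Rightarrow> 'a) \<Rightarrow> 'a list \<Rightarrow> bool" where
  "follows f P s h \<longleftrightarrow> (\<forall>i < length h. mover f i = P \<longrightarrow> h ! i = s (take i h))"

definition has_winning_strategy :: "'a set \<Rightarrow> 'a set set \<Rightarrow> player \<Rightarrow> player \<Rightarrow> bool" where
  "has_winning_strategy V E f P \<longleftrightarrow>
     (\<exists>s. strategy V f P s \<and>
          (\<forall>h. complete_play V h \<and> follows f P s h \<longrightarrow> wins_play E f P h))"

definition last_player :: "'a set \<Rightarrow> player \<Rightarrow> player" where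
  "last_player V f = (if odd (card V) then f else opponent f)"

definition second_to_last_player :: "'a set \<Rightarrow> player \<Rightarrow> player" where
  "second_to_last_player V f = opponent (last_player V f)"

text \<open>
  In both definitions below exactly one first player \<open>f\<close> satisfies the first conjunct.
\<close>

definition wins_as_last :: "'a set \<Rightarrow> 'a set set \<Rightarrow> player \<Rightarrow> bool" where
  "wins_as_last V E P \<longleftrightarrow> (\<exists>f. last_player V f = P \<and> has_winning_strategy V E f P)"

definition wins_as_second_to_last :: "'a set \<Rightarrow> 'a set set \<Rightarrow> player \<Rightarrow> bool" where
  "wins_as_second_to_last V E P \<longleftrightarrow>
     (\<exists>f. second_to_last_player V f = P \<and> has_winning_strategy V E f P)"

end

(*
  Both players want few vertices: Avoider wins iff the set he ends up with lies in a certain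
  down-closed family, and so does Enforcer for a suitable family, the set of Enforcer being the
  complement of that of Avoider. So it suffices to treat one player P with a down-closed family.

  Suppose that P, moving second, wins as last player on an even set R. Then P also wins, still
  moving second, on R with one more vertex x: P plays as on R until the opponent picks x; at that
  moment P has to move in a position on an even set which P wins as last player, that is, when the
  opponent moves, and induction applies. And P wins on R when moving first: P imagines that the
  opponent has picked some x and gives the winning reply y; now x is such an additional vertex.
  When P wins as last player on an odd set, with y as first move, P can treat y itself as
  the additional vertex instead of picking it.
*)

theory Submission
  imports Defs
begin

section \<open>Winning positions of one player\<close>

text \<open>
  The first argument is the family of final sets with which the player wins, the second says
  whether it is the player's turn, \<open>A\<close> is what the player has picked and \<open>R\<close> what is unpicked.
\<close>

inductive pos_wins :: "('a set \<Rightarrow> bool) \<Rightarrow> bool \<Rightarrow> 'a set \<Rightarrow> 'a set \<Rightarrow> bool" for Q where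
  over: "Q A \<Longrightarrow> pos_wins Q t A {}"
| own: "x \<in> R \<Longrightarrow> pos_wins Q False (insert x A) (R - {x}) \<Longrightarrow> pos_wins Q True A R"
| other: "R \<noteq> {} \<Longrightarrow> (\<And>x. x \<in> R \<Longrightarrow> pos_wins Q True A (R - {x})) \<Longrightarrow> pos_wins Q False A R"

lemma pos_wins_empty_iff: "pos_wins Q t A {} \<longleftrightarrow> Q A"
  by (auto intro: over elim: pos_wins.cases)

lemma pos_wins_own_iff:
  "R \<noteq> {} \<Longrightarrow> pos_wins Q True A R \<longleftrightarrow> (\<exists>x\<in>R. pos_wins Q False (insert x A) (R - {x}))"
  by (auto intro: own elim: pos_wins.cases)

lemma pos_wins_other_iff:
  "R \<noteq> {} \<Longrightarrow> pos_wins Q False A R \<longleftrightarrow> (\<forall>x\<in>R. pos_wins Q True A (R - {x}))"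
  by (auto intro: other elim: pos_wins.cases)

text \<open>The same moves from a smaller own set lead to a smaller final set, which
  \<open>Q\<close> still accepts. This lets the player give back a vertex.\<close>

lemma pos_wins_antimono:
  assumes "pos_wins Q t A R" "antimono Q" "B \<subseteq> A"
  shows "pos_wins Q t B R"
  using assms(1,3)
proof (induction arbitrary: B)
  case (over A t)
  then show ?case using antimonoD[OF assms(2)] by (auto intro: pos_wins.over)
next
  case (own x R A)
  have "pos_wins Q False (insert x B) (R - {x})" using own by blast
  then show ?case using own.hyps(1) by (rule pos_wins.own[rotated])
next
  case (other R A)
  then show ?case by (blast intro: pos_wins.other)
qed

section \<open>Last against second-to-last on positions\<close>

text \<open>Both claims go through one induction on \<open>card R\<close>, since each of them at a
  nonempty \<open>R\<close> uses the second claim for \<open>R\<close> without two vertices.\<close>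

lemma pos_wins_last_even:
  assumes "antimono Q" "finite R" "even (card R)" "pos_wins Q False A R"
  shows "pos_wins Q True A R" and "x \<notin> R \<Longrightarrow> pos_wins Q False A (insert x R)"
proof -
  have "pos_wins Q True A R \<and> (\<forall>x. x \<notin> R \<longrightarrow> pos_wins Q False A (insert x R))"
    using assms(2-4)
  proof (induction "card R" arbitrary: R A rule: less_induct)
    case less
    \<comment> \<open>Here \<open>y\<close> is the winning reply to \<open>z\<close>, and induction
      adds \<open>w\<close> to the even set that remains. It is used with \<open>w = z\<close>,
      where \<open>z\<close> was only imagined, and with \<open>w\<close> the extra vertex.\<close>
    have reply: "\<exists>y. y \<in> R \<and> y \<noteq> z \<and> pos_wins Q False (insert y A) (insert w (R - {z} - {y}))"
      if z: "z \<in> R" and w: "w \<notin> R - {z}" for z w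
    proof -
      have odd: "odd (card (R - {z}))"
        using less.prems z by (auto simp: card_gt_0_iff)
      then have ne: "R - {z} \<noteq> {}" by (metis card.empty even_zero)
      have "pos_wins Q True A (R - {z})"
        using less.prems(3) z by (metis empty_iff pos_wins_other_iff)
      then obtain y where y: "y \<in> R - {z}" "pos_wins Q False (insert y A) (R - {z} - {y})"
        using ne pos_wins_own_iff by metis
      have "even (card (R - {z} - {y}))"
        using odd y(1) less.prems(1) by simp
      moreover have "card (R - {z} - {y}) < card R"
        using z less.prems(1) by (intro psubset_card_mono) auto
      ultimately show ?thesis using less.hyps[of "R - {z} - {y}" "insert y A"] y w less.prems(1)
        by blast
    qed
    have first: "pos_wins Q True A R"
    proof (cases "R = {}")
      case True
      then show ?thesis using less.prems(3) by (simp add: pos_wins_empty_iff)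
    next
      case False
      then obtain x where x: "x \<in> R" by blast
      then obtain y where y: "y \<in> R" "y \<noteq> x"
        "pos_wins Q False (insert y A) (insert x (R - {x} - {y}))"
        using reply[of x x] by blast
      have "insert x (R - {x} - {y}) = R - {y}" using x y by blast
      then show ?thesis using y own by metis
    qed
    moreover have "pos_wins Q False A (insert x R)" if x: "x \<notin> R" for x
    proof (rule other)
      fix z assume z: "z \<in> insert x R"
      show "pos_wins Q True A (insert x R - {z})"
      \<comment> \<open>Once the opponent takes the extra vertex, the player has to move first on
        \<open>R\<close>; otherwise the reply to \<open>z\<close> on \<open>R\<close> serves, with
        \<open>x\<close> still unpicked.\<close>
      proof (cases "z = x")
        case True
        then show ?thesis using first x by simp
      next
        case False
        then have "z \<in> R" using z by blast
        then obtain y where y: "y \<in> R" "y \<noteq> z"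
          "pos_wins Q False (insert y A) (insert x (R - {z} - {y}))"
          using reply[of z x] x by blast
        have "insert x (R - {z} - {y}) = insert x R - {z} - {y}"
          using x y False by blast
        then show ?thesis using y own[of y "insert x R - {z}"] by auto
      qed
    qed simp
    ultimately show ?case by blast
  qed
  then show "pos_wins Q True A R" and "x \<notin> R \<Longrightarrow> pos_wins Q False A (insert x R)"
    by blast+
qed

lemma pos_wins_last_odd:
  assumes "antimono Q" "finite R" "odd (card R)" "pos_wins Q True A R"
  shows "pos_wins Q False A R"
proof -
  have "R \<noteq> {}" using assms(3) by auto
  then obtain y where y: "y \<in> R" "pos_wins Q False (insert y A) (R - {y})"
    using assms(4) pos_wins_own_iff by metis
  \<comment> \<open>The player gives back \<open>y\<close>, which then serves as the extra vertex
    for the even set \<open>R - {y}\<close>.\<close>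
  have "pos_wins Q False A (R - {y})"
    using pos_wins_antimono[OF y(2) assms(1)] by blast
  moreover have "even (card (R - {y}))" using assms y by simp
  ultimately have "pos_wins Q False A (insert y (R - {y}))"
    using assms by (intro pos_wins_last_even) auto
  then show ?thesis using y by (simp add: insert_absorb)
qed

section \<open>From histories and strategies to positions\<close>

lemma picked_by_Nil [simp]: "picked_by f P [] = {}"
  by (simp add: picked_by_def)

lemma picked_by_snoc [simp]:
  "picked_by f P (h @ [x :: 'a]) =
     (if mover f (length h) = P then insert x (picked_by f P h) else picked_by f P h)"
proof -
  let ?I = "\<lambda>n. {i. i < n \<and> mover f i = P}"
  have image: "picked_by f P g = (!) g ` ?I (length g)" for g :: "'a list"
    unfolding picked_by_def by blast
  have "?I (Suc n) = (if mover f n = P then insert n (?I n) else ?I n)" for n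
    by (auto simp: less_Suc_eq)
  moreover have "(!) (h @ [x]) ` ?I (length h) = (!) h ` ?I (length h)"
    by (rule image_cong) (simp_all add: nth_append)
  ultimately show ?thesis by (simp add: image)
qed

lemma follows_snoc [simp]:
  "follows f P s (h @ [x]) \<longleftrightarrow> follows f P s h \<and> (mover f (length h) = P \<longrightarrow> x = s h)"
  by (simp add: follows_def nth_append less_Suc_eq all_conj_distrib imp_disjL imp_conjL)

lemma mover_Suc_eq_iff: "mover f (Suc n) = P \<longleftrightarrow> mover f n \<noteq> P"
  by (cases f; cases P) (auto simp: mover_def)

lemma picked_by_Avoider:
  assumes "distinct h"
  shows "picked_by f Avoider h = set h - picked_by f Enforcer h"
  using assms
proof (induction h rule: rev_induct)
  case (snoc x h)
  have "x \<notin> picked_by f Enforcer h" using snoc.prems by (auto simp: picked_by_def)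
  then show ?case using snoc by (cases "mover f (length h)") (simp_all add: insert_Diff_if)
qed simp

text \<open>Both cases speak of the player's own final set \<open>A\<close>, so that both are
  down-closed; for Enforcer, \<open>V - A\<close> is what Avoider has picked.\<close>

fun final_wins :: "'a set \<Rightarrow> 'a set set \<Rightarrow> player \<Rightarrow> 'a set \<Rightarrow> bool" where
  "final_wins V E Avoider A \<longleftrightarrow> \<not> (\<exists>e\<in>E. e \<subseteq> A)"
| "final_wins V E Enforcer A \<longleftrightarrow> (\<exists>e\<in>E. e \<subseteq> V - A)"

lemma antimono_final_wins: "antimono (final_wins V E P)"
  by (cases P; intro antimonoI le_boolI) (simp; blast)+

lemma wins_play_iff_final_wins:
  "complete_play V h \<Longrightarrow> wins_play E f P h \<longleftrightarrow> final_wins V E P (picked_by f P h)"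
  by (cases P) (auto simp: complete_play_def picked_by_Avoider)

text \<open>Every history that follows \<open>s\<close> is a winning position, by induction on the
  number of unpicked vertices: \<open>s h\<close> is the player's move, and any move of the opponent
  still follows \<open>s\<close>.\<close>

lemma pos_wins_if_strategy:
  assumes "finite V" "strategy V f P s"
    and win: "\<And>h. complete_play V h \<Longrightarrow> follows f P s h \<Longrightarrow> wins_play E f P h"
    and "history V h" "follows f P s h"
  shows "pos_wins (final_wins V E P) (mover f (length h) = P) (picked_by f P h) (V - set h)"
  using assms(4,5)
proof (induction "card (V - set h)" arbitrary: h rule: less_induct)
  case less
  have step: "pos_wins (final_wins V E P) (mover f (length h) \<noteq> P)
      (picked_by f P (h @ [x])) (V - set h - {x})"
    if "x \<in> V - set h" "follows f P s (h @ [x])" for x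
  proof -
    have "V - set (h @ [x]) = V - set h - {x}" by auto
    moreover have "card (V - set h - {x}) < card (V - set h)"
      using that(1) assms(1) by (meson card_Diff1_less finite_Diff)
    moreover have "history V (h @ [x])"
      using less.prems(1) that(1) by (auto simp: history_def)
    ultimately show ?thesis
      using less.hyps[of "h @ [x]"] that(2) by (simp add: mover_Suc_eq_iff)
  qed
  show ?case
  proof (cases "set h = V")
    case True
    then have "complete_play V h" using less.prems by (simp add: history_def complete_play_def)
    then show ?thesis
      using win less.prems True by (simp add: wins_play_iff_final_wins pos_wins_empty_iff)
  next
    case False
    then have ne: "V - set h \<noteq> {}" using less.prems by (auto simp: history_def)
    show ?thesis
    proof (cases "mover f (length h) = P")
      case True
      then have "s h \<in> V - set h"
        using assms(2) less.prems False unfolding strategy_def by blast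
      then show ?thesis using step[of "s h"] less.prems True by (auto intro: own)
    next
      case m: False
      then show ?thesis using step less.prems ne by (auto intro: other)
    qed
  qed
qed

lemma strategy_if_pos_wins:
  assumes "pos_wins (final_wins V E P) (f = P) {} V"
  shows "has_winning_strategy V E f P"
proof -
  let ?Q = "final_wins V E P"
  define good where "good h x \<longleftrightarrow> x \<in> V - set h \<and>
    pos_wins ?Q False (insert x (picked_by f P h)) (V - set h - {x})" for h x
  \<comment> \<open>The second default is needed because \<open>strategy\<close> demands a legal
    move also at histories from which the player no longer wins.\<close>
  define s where "s h = (if \<exists>x. good h x then SOME x. good h x else SOME x. x \<in> V - set h)" for h
  have s_good: "good h (s h)" if "\<exists>x. good h x" for h
    using that someI_ex[of "good h"] by (simp add: s_def)
  have s_unpicked: "s h \<in> V - set h" if "V - set h \<noteq> {}" for h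
  proof (cases "\<exists>x. good h x")
    case True
    then show ?thesis using s_good good_def by blast
  next
    case False
    then show ?thesis using that some_in_eq[of "V - set h"] by (simp add: s_def)
  qed
  \<comment> \<open>Play along \<open>s\<close> never leaves the winning positions; at a complete
    play this says that the final set is a winning one.\<close>
  have inv: "pos_wins ?Q (mover f (length h) = P) (picked_by f P h) (V - set h)"
    if "history V h" "follows f P s h" for h
    using that
  proof (induction h rule: rev_induct)
    case Nil
    then show ?case using assms by (simp add: mover_def)
  next
    case (snoc x h)
    then have x: "x \<in> V - set h"
      and IH: "pos_wins ?Q (mover f (length h) = P) (picked_by f P h) (V - set h)"
      by (auto simp: history_def)
    have eq: "V - set (h @ [x]) = V - set h - {x}" by auto
    show ?case
    proof (cases "mover f (length h) = P")
      case True
      then have "\<exists>x. good h x"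
        using IH x pos_wins_own_iff[of "V - set h" ?Q "picked_by f P h"]
        by (auto simp: good_def)
      then have "good h x" using s_good snoc.prems True by auto
      then show ?thesis using True by (simp add: good_def mover_Suc_eq_iff eq del: set_append)
    next
      case False
      then have "pos_wins ?Q True (picked_by f P h) (V - set h - {x})"
        using IH x pos_wins_other_iff[of "V - set h" ?Q "picked_by f P h"] by auto
      then show ?thesis using False by (simp add: mover_Suc_eq_iff eq del: set_append)
    qed
  qed
  have "strategy V f P s"
    unfolding strategy_def using s_unpicked by (auto simp: history_def)
  moreover have "wins_play E f P h" if "complete_play V h" "follows f P s h" for h
    using inv[of h] that
    by (simp add: wins_play_iff_final_wins pos_wins_empty_iff complete_play_def history_def)
  ultimately show ?thesis unfolding has_winning_strategy_def by blast
qed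

lemma has_winning_strategy_iff_pos_wins:
  assumes "finite V"
  shows "has_winning_strategy V E f P \<longleftrightarrow> pos_wins (final_wins V E P) (f = P) {} V"
proof
  assume "has_winning_strategy V E f P"
  then obtain s where "strategy V f P s"
    "\<And>h. complete_play V h \<Longrightarrow> follows f P s h \<Longrightarrow> wins_play E f P h"
    unfolding has_winning_strategy_def by blast
  from pos_wins_if_strategy[OF assms this, of "[]"]
  show "pos_wins (final_wins V E P) (f = P) {} V"
    by (simp add: history_def follows_def mover_def)
qed (rule strategy_if_pos_wins)

lemma wins_as_second_to_last_if_last:
  assumes "finite V" "wins_as_last V E P"
  shows "wins_as_second_to_last V E P"
proof -
  let ?Q = "final_wins V E P"
  obtain f where f: "last_player V f = P" and win: "pos_wins ?Q (f = P) {} V"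
    using assms has_winning_strategy_iff_pos_wins unfolding wins_as_last_def by blast
  \<comment> \<open>As \<open>V\<close> is fixed, exchanging the last and the second-to-last player
    means exchanging who moves first.\<close>
  have opp: "second_to_last_player V (opponent f) = P"
    using f by (cases f) (auto simp: second_to_last_player_def last_player_def split: if_splits)
  have "pos_wins ?Q (opponent f = P) {} V"
  proof (cases "even (card V)")
    case True
    then have "opponent f = P" using f by (simp add: last_player_def)
    moreover from this have "f \<noteq> P" by (cases f) auto
    ultimately show ?thesis
      using win True assms(1) pos_wins_last_even(1)[OF antimono_final_wins] by simp
  next
    case False
    then have "f = P" using f by (simp add: last_player_def)
    moreover from this have "opponent f \<noteq> P" by (cases f) auto
    ultimately show ?thesis
      using win False assms(1) pos_wins_last_odd[OF antimono_final_wins] by simp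
  qed
  then show ?thesis
    using opp strategy_if_pos_wins unfolding wins_as_second_to_last_def by blast
qed

theorem theorem2p2:
  fixes V :: "'a set" and E :: "'a set set"
  assumes "hypergraph V E"
  shows "(wins_as_last V E Avoider \<longrightarrow> wins_as_second_to_last V E Avoider) \<and>
         (wins_as_last V E Enforcer \<longrightarrow> wins_as_second_to_last V E Enforcer)"
  using assms wins_as_second_to_last_if_last unfolding hypergraph_def by blast

end
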